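(* Let $b,n$ be natural numbers with $1<n<b$, let $M$ be the $(n,b)$-mother graph, let $\{C_0,C_1,\ldots,C_m\}$ be the collection of (directed) cycles of $M$, and for each $j$ let $\Delta_j$ be the multi-image of $C_j$ in the $(n,b)$-Hoey-Sloane multigraph $\Delta$. Let $I$ be a multiset whose support is a subset of $\{0,1,\ldots,m\}$. If the multigraph union $\Delta_I=\biguplus_{j\in I}\Delta_j$ contains an Eulerian circuit (a closed walk using every multiedge of $\Delta_I$ exactly once) beginning and ending at the state $0$, then the multiset union $C_I=\biguplus_{j\in I}C_j$ of mother-graph cycles can be ordered into an $(n,b)$-permutiple string.
   Context: Base-$b$ digits are the integers $0,\ldots,b-1$, and $(d_k,\ldots,d_0)_b=\sum_{j=0}^k d_jb^j$. For integer $x$, $\lambda(x)$ is the least non-negative residue of $x$ mod $b$. The $(n,b)$-mother graph $M$ is the directed graph with vertex set the base-$b$ digits and edges the ordered pairs $(d_1,d_2)$ of digits with $\lambda(d_1+(b-n)d_2)\leq n-1$. A cycle of $M$ is a directed cycle (loops allowed), regarded as its set of edges. For every edge $(d_1,d_2)$ of $M$ there is a unique pair of integers $(c_1,c_2)$ with $0\le c_1,c_2\le n-1$ and $bc_2-c_1=nd_2-d_1$; we say $(d_1,d_2)$ induces the transition from state $c_1$ to state $c_2$. The $(n,b)$-Hoey-Sloane multigraph $\Delta$ has vertex set (states) $\{0,1,\ldots,n-1\}$ and, for each edge $(d_1,d_2)$ of $M$, one directed multiedge from $c_1$ to $c_2$ (the transition it induces) labeled $(d_1,d_2)$. For a cycle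 $C_j$ of $M$, its multi-image $\Delta_j$ is the sub-multigraph of $\Delta$ consisting of the multiedges whose labels lie in $C_j$ (with their endpoint states as vertices). For a multiset $I$ of indices, $C_I=\biguplus_{j\in I}C_j$ is the multiset union (each $C_j$ counted with its multiplicity in $I$), and $\Delta_I=\biguplus_{j\in I}\Delta_j$ is the multigraph union in which multiedges are counted with multiplicity. The language $L$ consists of the finite strings $s=(d_0,\hat d_0)(d_1,\hat d_1)\cdots(d_k,\hat d_k)$ of edges of $M$ for which there are states $c_0=0,c_1,\ldots,c_{k+1}=0$ in $\{0,\ldots,n-1\}$ with $(d_j,\hat d_j)$ inducing the transition from $c_j$ to $c_{j+1}$ for every $j$ (i.e. $bc_{j+1}-c_j=n\hat d_j-d_j$). An $(n,b)$-permutiple string is a member $s$ of $L$ for which there is a permutation $\sigma$ of $\{0,\ldots,k\}$ with $\hat d_j=d_{\sigma(j)}$ for all $j$, so that $(d_k,\ldots,d_0)_b=n\,(d_{\sigma(k)},\ldots,d_{\sigma(0)})_b$. "$C_I$ can be ordered into a permutiple string" means the elements of the multiset $C_I$, each used exactly as many times as its multiplicity, can be arranged in a sequence forming a permutiple string. *)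

theory Defs
  imports
    "Graph_Theory.Arc_Walk"
    "HOL-Library.Multiset"
    "HOL-Combinatorics.Permutations"
begin

type_synonym edge = "nat \<times> nat"

definition lam :: "nat \<Rightarrow> int \<Rightarrow> int" where
  "lam b x = x mod int b"

definition mother_graph :: "nat \<Rightarrow> nat \<Rightarrow> (nat, edge) pre_digraph" where
  "mother_graph n b =
    \<lparr> verts = {0..<b},
      arcs = {(d1, d2). d1 \<in> {0..<b} \<and> d2 \<in> {0..<b} \<and>
                lam b (int d1 + (int b - int n) * int d2) \<le> int n - 1},
      tail = fst,
      head = snd \<rparr>"

text \<open>Cycles may be loops and do not repeat vertices; they are taken as sets of edges, so
  the starting point is forgotten.\<close>

definition mother_cycles :: "nat \<Rightarrow> nat \<Rightarrow> edge set set" where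
  "mother_cycles n b = {set p | p. pre_digraph.cycle (mother_graph n b) p}"

definition induces :: "nat \<Rightarrow> nat \<Rightarrow> edge \<Rightarrow> nat \<Rightarrow> nat \<Rightarrow> bool" where
  "induces n b e c1 c2 \<longleftrightarrow>
    c1 \<in> {0..<n} \<and> c2 \<in> {0..<n} \<and>
    int b * int c2 - int c1 = int n * int (snd e) - int (fst e)"

lemma induces_unique:
  assumes "1 < n" "n < b" "e \<in> arcs (mother_graph n b)"
  shows "\<exists>!c. induces n b e (fst c) (snd c)"
proof -
  obtain d1 d2 where e: "e = (d1, d2)" by (cases e)
  have d: "d1 < b" "d2 < b"
    and l: "(int d1 + (int b - int n) * int d2) mod int b \<le> int n - 1"
    using assms(3) by (auto simp: e mother_graph_def lam_def)
  define r where "r = (int d1 + (int b - int n) * int d2) mod int b"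
  have r: "0 \<le> r" "r \<le> int n - 1" using assms l by (auto simp: r_def)
  define q where "q = int d2 - (int d1 + (int b - int n) * int d2) div int b"
  have "int d1 + (int b - int n) * int d2
      = int b * ((int d1 + (int b - int n) * int d2) div int b) + r"
    unfolding r_def by (simp only: mult_div_mod_eq)
  then have q: "int b * q - r = int n * int d2 - int d1"
    by (simp add: q_def algebra_simps)
  have "int n * int d2 \<le> int n * (int b - 1)"
    using d by (intro mult_left_mono) auto
  then have "int b * q < int b * int n"
    using q r by (simp add: algebra_simps)
  then have q_less: "q < int n"
    using assms by simp
  have "int b * (- 1) < int b * q"
  proof -
    have "0 \<le> int n * int d2" "int d1 < int b" using d by simp_all
    then show ?thesis using q r by linarith
  qed
  moreover have "int b > 0"
    using assms by simp
  ultimately have "- 1 < q"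
    by (metis mult_less_cancel_left_pos)
  then have q_ge: "0 \<le> q"
    by simp
  show ?thesis
  proof (rule ex1I)
    show "induces n b e (fst (nat r, nat q)) (snd (nat r, nat q))"
      using q q_less q_ge r by (auto simp: induces_def e)
  next
    fix c assume c: "induces n b e (fst c) (snd c)"
    have eq: "int b * int (snd c) - int (fst c) = int b * q - r"
      using c q by (simp add: induces_def e)
    have "int (fst c) = r + int b * (int (snd c) - q)"
      using eq by (simp add: algebra_simps)
    then have "int (fst c) mod int b = r mod int b" by simp
    moreover have "int (fst c) < int b" "r < int b"
      using c r assms by (auto simp: induces_def)
    ultimately have "int (fst c) = r" using r by simp
    moreover from this have "int (snd c) = q" using eq assms by simp
    ultimately show "c = (nat r, nat q)" by (cases c) auto
  qed
qed

text \<open>A labelled multiedge is a triple (source state, label, target state). By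
  \<open>induces_unique\<close> every edge of the mother graph labels exactly one of them.\<close>

type_synonym transition = "nat \<times> edge \<times> nat"

definition hoey_sloane :: "nat \<Rightarrow> nat \<Rightarrow> (nat, transition) pre_digraph" where
  "hoey_sloane n b =
    \<lparr> verts = {0..<n},
      arcs = {(c1, e, c2). e \<in> arcs (mother_graph n b) \<and> induces n b e c1 c2},
      tail = (\<lambda>(c1, e, c2). c1),
      head = (\<lambda>(c1, e, c2). c2) \<rparr>"

definition multi_image :: "nat \<Rightarrow> nat \<Rightarrow> edge set \<Rightarrow> (nat, transition) pre_digraph" where
  "multi_image n b C =
    (let D = hoey_sloane n b; A = {(c1, e, c2) \<in> arcs D. e \<in> C} in
      \<lparr> verts = tail D ` A \<union> head D ` A, arcs = A, tail = tail D, head = head D \<rparr>)"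

text \<open>Union with multiplicities: the arc \<open>(a, j, i)\<close> is the arc \<open>a\<close> of the \<open>i\<close>-th copy of
  \<open>D j\<close>, where \<open>D j\<close> occurs as often as \<open>j\<close> does in \<open>I\<close>. Vertices are shared
  between the copies, arcs are not.\<close>

definition multigraph_union ::
  "('i \<Rightarrow> ('v, 'e) pre_digraph) \<Rightarrow> 'i multiset \<Rightarrow> ('v, 'e \<times> 'i \<times> nat) pre_digraph" where
  "multigraph_union D I =
    \<lparr> verts = (\<Union>j\<in>set_mset I. verts (D j)),
      arcs = {(a, j, i). a \<in> arcs (D j) \<and> i < count I j},
      tail = (\<lambda>(a, j, i). tail (D j) a),
      head = (\<lambda>(a, j, i). head (D j) a) \<rparr>"

text \<open>A \<open>trail\<close> is a walk that uses no arc twice.\<close>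

definition eulerian_circuit :: "('v, 'e) pre_digraph \<Rightarrow> 'v \<Rightarrow> 'e list \<Rightarrow> bool" where
  "eulerian_circuit G u p \<longleftrightarrow> pre_digraph.trail G u p u \<and> set p = arcs G"

text \<open>Strings are written least significant digit first and are nonempty.\<close>

definition language :: "nat \<Rightarrow> nat \<Rightarrow> edge list set" where
  "language n b =
    {s. s \<noteq> [] \<and> set s \<subseteq> arcs (mother_graph n b) \<and>
        (\<exists>c. c 0 = 0 \<and> c (length s) = 0 \<and>
             (\<forall>j<length s. induces n b (s ! j) (c j) (c (Suc j))))}"

definition permutiple_string :: "nat \<Rightarrow> nat \<Rightarrow> edge list \<Rightarrow> bool" where
  "permutiple_string n b s \<longleftrightarrow>
    s \<in> language n b \<and>
    (\<exists>\<sigma>. \<sigma> permutes {..<length s} \<and>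
         (\<forall>j<length s. snd (s ! j) = fst (s ! \<sigma> j)))"

lemma language_value:
  assumes "s \<in> language n b"
  shows "(\<Sum>j<length s. fst (s ! j) * b ^ j) = n * (\<Sum>j<length s. snd (s ! j) * b ^ j)"
proof -
  obtain c where c: "c 0 = 0" "c (length s) = 0"
    and t: "\<forall>j<length s. induces n b (s ! j) (c j) (c (Suc j))"
    using assms by (auto simp: language_def)
  have "int n * (\<Sum>j<k. int (snd (s ! j)) * int b ^ j) - (\<Sum>j<k. int (fst (s ! j)) * int b ^ j)
      = int (c k) * int b ^ k" if "k \<le> length s" for k
    using that
  proof (induction k)
    case 0
    then show ?case using c by simp
  next
    case (Suc k)
    have "int b * int (c (Suc k)) - int (c k) = int n * int (snd (s ! k)) - int (fst (s ! k))"
      using t Suc.prems by (simp add: induces_def)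
    then have "int b ^ k * (int b * int (c (Suc k)) - int (c k))
        = int b ^ k * (int n * int (snd (s ! k)) - int (fst (s ! k)))" by simp
    then show ?case using Suc.IH Suc.prems by (simp add: algebra_simps)
  qed
  from this[of "length s"] have
    "int n * (\<Sum>j<length s. int (snd (s ! j)) * int b ^ j) = (\<Sum>j<length s. int (fst (s ! j)) * int b ^ j)"
    using c by simp
  then have "int (n * (\<Sum>j<length s. snd (s ! j) * b ^ j)) = int (\<Sum>j<length s. fst (s ! j) * b ^ j)"
    by simp
  then show ?thesis by linarith
qed

lemma permutiple_value:
  assumes "s \<in> language n b" "\<forall>j<length s. snd (s ! j) = fst (s ! \<sigma> j)"
  shows "(\<Sum>j<length s. fst (s ! j) * b ^ j) = n * (\<Sum>j<length s. fst (s ! \<sigma> j) * b ^ j)"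
  using language_value[OF assms(1)] assms(2) by simp

end

theory Submission
  imports Defs
begin

text \<open>The labels along the Eulerian circuit form the string: consecutive arcs share a state and
  the circuit starts and ends at \<open>0\<close>, so the string lies in the language, and by uniqueness of
  the induced transition each label occurs as often as in \<open>C\<^sub>I\<close>. Every cycle enters each digit as
  often as it leaves it, so the first and the second digits of the string agree as multisets,
  which gives the permutation.\<close>

context pre_digraph
begin

text \<open>Supplies the sequence of states that membership in \<open>language\<close> asks
  for.\<close>

lemma cas_states:
  assumes "cas u p v"
  obtains c where "c 0 = u" "c (length p) = v"
    "\<And>j. j < length p \<Longrightarrow> tail G (p ! j) = c j \<and> head G (p ! j) = c (Suc j)"
proof -
  have "\<exists>c. c 0 = u \<and> c (length p) = v \<and>
      (\<forall>j<length p. tail G (p ! j) = c j \<and> head G (p ! j) = c (Suc j))"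
    using assms
  proof (induction p arbitrary: u)
    case Nil
    then show ?case by auto
  next
    case (Cons e p)
    then obtain c where "c 0 = head G e" "c (length p) = v"
      "\<forall>j<length p. tail G (p ! j) = c j \<and> head G (p ! j) = c (Suc j)"
      by auto
    with Cons.prems show ?case
      by (intro exI[of _ "case_nat u c"]) (auto simp: less_Suc_eq_0_disj)
  qed
  with that show thesis by blast
qed

text \<open>Both sides count the vertices visited by the walk: all tails and then the end point, or
  the start point and then all heads. For a closed walk the extra points cancel.\<close>

lemma cas_mset_tail_head:
  "cas u p v \<Longrightarrow> add_mset v (mset (map (tail G) p)) = add_mset u (mset (map (head G) p))"
proof (induction p arbitrary: u)
  case (Cons e p)
  then show ?case
    using Cons.IH[of "head G e"] by (auto simp: add_mset_commute)
qed auto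

lemma cas_tl_awalk_verts: "cas u p v \<Longrightarrow> tl (awalk_verts u p) = map (head G) p"
proof (induction p arbitrary: u)
  case (Cons e p)
  then show ?case
    by (cases p) auto
qed auto

lemma cycle_mset_set_tail_head:
  assumes "cycle p"
  shows "image_mset (tail G) (mset_set (set p)) = image_mset (head G) (mset_set (set p))"
proof -
  obtain u where u: "cas u p u" "distinct (tl (awalk_verts u p))"
    using assms by (auto simp: cycle_def awalk_def)
  \<comment> \<open>The heads along a cycle are pairwise distinct, so no arc repeats and
    \<open>mset_set (set p)\<close> is \<open>mset p\<close>.\<close>
  then have "distinct p"
    by (auto simp: cas_tl_awalk_verts distinct_map)
  then show ?thesis
    using cas_mset_tail_head[OF u(1)] by (simp add: mset_set_set)
qed

end

lemma image_mset_sum_mset: "image_mset f (\<Sum>j\<in>#I. g j) = (\<Sum>j\<in>#I. image_mset f (g j))"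
  by (induction I) auto

lemma finite_arcs_multigraph_union:
  assumes "\<And>j. j \<in># I \<Longrightarrow> finite (arcs (D j))"
  shows "finite (arcs (multigraph_union D I))"
proof -
  have "arcs (multigraph_union D I) = (\<Union>j\<in>set_mset I. arcs (D j) \<times> {j} \<times> {..<count I j})"
    by (auto simp: multigraph_union_def simp flip: count_greater_zero_iff)
  then show ?thesis using assms by simp
qed

text \<open>Turns the copies with distinct indices back into multiplicities. Finiteness matters
  because \<open>mset_set\<close> of an infinite set is empty.\<close>

lemma image_mset_arcs_multigraph_union:
  assumes "\<And>j. j \<in># I \<Longrightarrow> finite (arcs (D j))"
  shows "image_mset (\<lambda>x. f (fst x)) (mset_set (arcs (multigraph_union D I))) =
    (\<Sum>j\<in>#I. image_mset f (mset_set (arcs (D j))))"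
  using assms
proof (induction I)
  case empty
  then show ?case by (simp add: multigraph_union_def case_prod_unfold)
next
  case (add k I)
  \<comment> \<open>Copies of \<open>D k\<close> already present have indices below
    \<open>count I k\<close>, so one more \<open>k\<close> adds exactly the copy with this
    index.\<close>
  let ?new = "(\<lambda>a. (a, k, count I k)) ` arcs (D k)"
  have arcs: "arcs (multigraph_union D (add_mset k I)) = arcs (multigraph_union D I) \<union> ?new"
    by (auto simp: multigraph_union_def less_Suc_eq split: if_splits)
  have disj: "arcs (multigraph_union D I) \<inter> ?new = {}"
    by (auto simp: multigraph_union_def)
  have fin: "finite (arcs (multigraph_union D I))" "finite ?new"
    using add.prems by (auto intro!: finite_arcs_multigraph_union)
  have "mset_set ?new = image_mset (\<lambda>a. (a, k, count I k)) (mset_set (arcs (D k)))"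
    by (rule image_mset_mset_set[symmetric]) (auto intro: inj_onI)
  then show ?case
    using add by (simp add: arcs mset_set_Union[OF fin disj] multiset.map_comp comp_def)
qed

lemma mother_cycleE:
  assumes "C \<in> mother_cycles n b"
  obtains p where "pre_digraph.cycle (mother_graph n b) p" "C = set p"
    "C \<subseteq> arcs (mother_graph n b)" "C \<noteq> {}"
  using assms by (auto simp: mother_cycles_def pre_digraph.cycle_def pre_digraph.awalk_def)

lemma mother_cycle_mset_set_fst_snd:
  assumes "C \<in> mother_cycles n b"
  shows "image_mset fst (mset_set C) = image_mset snd (mset_set C)"
  using assms
proof (rule mother_cycleE)
  fix p assume "pre_digraph.cycle (mother_graph n b) p" "C = set p"
  with pre_digraph.cycle_mset_set_tail_head[of "mother_graph n b" p] show ?thesis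
    by (simp add: mother_graph_def)
qed

lemma arcs_multi_image:
  "arcs (multi_image n b C) =
    {(c1, e, c2). e \<in> arcs (mother_graph n b) \<and> e \<in> C \<and> induces n b e c1 c2}"
  by (auto simp: multi_image_def hoey_sloane_def Let_def)

text \<open>Injectivity is the uniqueness of the induced transition, surjectivity its
  existence.\<close>

lemma bij_betw_label_multi_image:
  assumes "1 < n" "n < b" "C \<subseteq> arcs (mother_graph n b)"
  shows "bij_betw (fst \<circ> snd) (arcs (multi_image n b C)) C"
proof (rule bij_betw_imageI)
  show "inj_on (fst \<circ> snd) (arcs (multi_image n b C))"
    using induces_unique[OF assms(1,2)] by (fastforce simp: arcs_multi_image inj_on_def)
  show "(fst \<circ> snd) ` arcs (multi_image n b C) = C"
  proof (intro equalityI subsetI)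
    fix e assume "e \<in> C"
    with assms induces_unique[of n b e] obtain c where "induces n b e (fst c) (snd c)"
      by blast
    with \<open>e \<in> C\<close> assms(3) have "(fst c, e, snd c) \<in> arcs (multi_image n b C)"
      by (auto simp: arcs_multi_image)
    then show "e \<in> (fst \<circ> snd) ` arcs (multi_image n b C)"
      by force
  qed (auto simp: arcs_multi_image)
qed

lemma permutiple_stringI:
  assumes "s \<in> language n b" "mset (map fst s) = mset (map snd s)"
  shows "permutiple_string n b s"
proof -
  \<comment> \<open>The equation is reversed because the second digits are to be read off from the
    permuted first digits.\<close>
  obtain \<sigma> where \<sigma>: "\<sigma> permutes {..<length (map fst s)}"
    "permute_list \<sigma> (map fst s) = map snd s"
    using mset_eq_permutation[OF assms(2)[symmetric]] by blast
  have "snd (s ! j) = fst (s ! \<sigma> j)" if "j < length s" for j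
  proof -
    have "\<sigma> j < length s"
      using permutes_in_image[OF \<sigma>(1), of j] that by simp
    moreover have "map snd s ! j = map fst s ! \<sigma> j"
      using permute_list_nth[OF \<sigma>(1), of j] \<sigma>(2) that by simp
    ultimately show ?thesis using that by simp
  qed
  with \<sigma>(1) assms(1) show ?thesis
    by (auto simp: permutiple_string_def)
qed

theorem theorem4p2:
  fixes n b m :: nat
    and C :: "nat \<Rightarrow> edge set"
    and I :: "nat multiset"
  assumes "1 < n" and "n < b"
    and "bij_betw C {0..m} (mother_cycles n b)"
    and "set_mset I \<subseteq> {0..m}"
    and "\<exists>p. eulerian_circuit (multigraph_union (\<lambda>j. multi_image n b (C j)) I) 0 p"
  shows "\<exists>s. mset s = (\<Sum>j\<in>#I. mset_set (C j)) \<and> permutiple_string n b s"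
proof -
  let ?D = "\<lambda>j. multi_image n b (C j)"
  let ?G = "multigraph_union ?D I"
  obtain p where p: "pre_digraph.cas ?G 0 p 0" "distinct p" "set p = arcs ?G" "0 \<in> verts ?G"
    using assms(5)
    by (auto simp: eulerian_circuit_def pre_digraph.trail_def pre_digraph.awalk_def)
  have cycle: "C j \<in> mother_cycles n b" if "j \<in># I" for j
    using that assms(3,4) by (auto simp: bij_betw_def)
  have label: "bij_betw (fst \<circ> snd) (arcs (?D j)) (C j)" if "j \<in># I" for j
    using cycle[OF that] assms(1,2) by (metis bij_betw_label_multi_image mother_cycleE)
  have fin: "finite (arcs (?D j))" if "j \<in># I" for j
    using label[OF that] cycle[OF that]
    by (metis List.finite_set bij_betw_finite mother_cycleE)
  \<comment> \<open>An arc of \<open>?G\<close> has the form \<open>((c1, e, c2), j, i)\<close>, and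
    \<open>s\<close> keeps only the label \<open>e\<close>. As \<open>p\<close> is a trail through
    all arcs, \<open>mset p\<close> is \<open>mset_set (arcs ?G)\<close>.\<close>
  define s where "s = map (\<lambda>x. fst (snd (fst x))) p"
  have "mset s = image_mset (\<lambda>x. (fst \<circ> snd) (fst x)) (mset_set (arcs ?G))"
    using p(2,3) by (simp add: s_def mset_set_set flip: p(3))
  also have "\<dots> = (\<Sum>j\<in>#I. image_mset (fst \<circ> snd) (mset_set (arcs (?D j))))"
    by (rule image_mset_arcs_multigraph_union) (rule fin)
  also have "\<dots> = (\<Sum>j\<in>#I. mset_set (C j))"
    using label
    by (intro arg_cong[where f = sum_mset] image_mset_cong)
      (simp add: image_mset_mset_set bij_betw_def)
  finally have mset_s: "mset s = (\<Sum>j\<in>#I. mset_set (C j))" .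
  have "mset (map fst s) = (\<Sum>j\<in>#I. image_mset fst (mset_set (C j)))"
    by (simp add: mset_s image_mset_sum_mset multiset.map_comp comp_def)
  also have "\<dots> = (\<Sum>j\<in>#I. image_mset snd (mset_set (C j)))"
    using cycle
    by (intro arg_cong[where f = sum_mset] image_mset_cong mother_cycle_mset_set_fst_snd)
  also have "\<dots> = mset (map snd s)"
    by (simp add: mset_s image_mset_sum_mset multiset.map_comp comp_def)
  finally have fst_snd: "mset (map fst s) = mset (map snd s)" .
  have "s \<in> language n b"
  proof -
    \<comment> \<open>A string in \<open>language\<close> must be nonempty. The state 0 is a vertex
      of \<open>?G\<close>, so \<open>I\<close> has an element \<open>j\<close>; the cycle
      \<open>C j\<close> has an edge, and its transition occurs in copy 0, which exists since
      \<open>count I j\<close> is positive.\<close>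
    obtain j where "j \<in># I"
      using p(4) by (auto simp: multigraph_union_def)
    moreover from cycle[OF this] label[OF this] obtain a where "a \<in> arcs (?D j)"
      by (metis bij_betw_empty1 ex_in_conv mother_cycleE)
    ultimately have "(a, j, 0) \<in> set p"
      unfolding p(3) by (simp add: multigraph_union_def)
    then have "s \<noteq> []"
      by (auto simp: s_def)
    obtain c where c: "c 0 = 0" "c (length p) = 0"
      and step: "\<And>k. k < length p \<Longrightarrow> tail ?G (p ! k) = c k \<and> head ?G (p ! k) = c (Suc k)"
      using pre_digraph.cas_states[OF p(1)] by metis
    have trans: "s ! k \<in> arcs (mother_graph n b) \<and> induces n b (s ! k) (c k) (c (Suc k))"
      if "k < length p" for k
    proof -
      have "p ! k \<in> arcs ?G"
        using that p(3) nth_mem by blast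
      then show ?thesis
        \<comment> \<open>Every arc of \<open>?G\<close> carries the states induced by its label as
          tail and head; \<open>step\<close> identifies them with \<open>c k\<close> and
          \<open>c (Suc k)\<close>.\<close>
        using step[OF that] that
        by (auto simp: s_def multigraph_union_def arcs_multi_image)
          (auto simp: multi_image_def hoey_sloane_def Let_def)
    qed
    have "length s = length p"
      by (simp add: s_def)
    moreover from this trans have "set s \<subseteq> arcs (mother_graph n b)"
      by (metis in_set_conv_nth subsetI)
    ultimately show ?thesis
      using \<open>s \<noteq> []\<close> c trans unfolding language_def by (intro CollectI conjI exI[of _ c]) auto
  qed
  with mset_s fst_snd show ?thesis
    using permutiple_stringI by blast
qed

end
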